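(* Let $s\ge2$ and $m\ge1$ be integers, let $\eta\ge0$ be the damping parameter, and let $f_D,f_A:\mathbb{R}^d\to\mathbb{R}^d$ be sufficiently smooth. Then the partitioned Runge-Kutta-Chebyshev method with parameters $s,m$ is second-order consistent for the ODE system $$y'(t)=f_D(y(t))+f_A(y(t)),\qquad y(t_0)=a\in\mathbb{R}^d,\qquad t\in[t_0,T];$$ that is, if $y$ is the exact solution and $y_{n+1}$ is the result of one step of the method with step size $h$ starting from $y_n=y(t_n)$, then $y(t_n+h)-y_{n+1}=\mathcal{O}(h^3)$ as $h\to0$.
   Context: Let $T_j$ be the Chebyshev polynomial of the first kind of degree $j$. For an integer $s\ge2$ and damping parameter $\eta\ge 0$ put $$\omega_0=1+\frac{\eta}{s^2},\quad \omega_1=\frac{T_s'(\omega_0)}{T_s''(\omega_0)},\quad b_j=\frac{T_j''(\omega_0)}{(T_j'(\omega_0))^2}\ (2\le j\le s),\quad b_0=b_1=b_2,$$ $$\tilde u_1=\omega_1b_1,\quad \tilde u_j=2\omega_1\frac{b_j}{b_{j-1}},\quad u_j=2\omega_0\frac{b_j}{b_{j-1}},\quad v_j=-\frac{b_j}{b_{j-2}},\quad \tilde\gamma_j=-\big(1-b_{j-1}T_{j-1}(\omega_0)\big)\tilde u_j\quad(2\le j\le s).$$ Partitioned method: for step size $h>0$ and integer $m\ge1$, one step $y_n\mapsto y_{n+1}$ is $$\hat K_0=y_n,\qquad \hat K_i=\hat K_{i-1}+\tfrac{1}{2m}hf_A(\hat K_{i-1}),\quad i=1,\dots,m,$$ $$K_0=\hat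 K_m,\qquad K_1=K_0+\tilde u_1hf_D(K_0),$$ $$K_j=u_jK_{j-1}+v_jK_{j-2}+(1-u_j-v_j)K_0+\tilde u_jhf_D(K_{j-1})+\tilde\gamma_jhf_D(K_0),\quad j=2,\dots,s,$$ and for $i=1,\dots,m$ $$K_{s+3i-2}=K_{s+3i-3}+\tfrac{1}{6m}hf_A(K_{s+3i-3}),\qquad K_{s+3i-1}=K_{s+3i-3}-\tfrac{1}{6m}hf_A(K_{s+3i-2}),$$ $$K_{s+3i}=K_{s+3i-3}+\tfrac{2}{m}hf_A(K_{s+3i-3})-\tfrac{3}{2m}hf_A(K_{s+3i-1}),$$ and $y_{n+1}=K_{s+3m}$. Here $s$, $m$, $\eta$ are fixed as $h\to0$. *)

theory Defs
  imports "HOL-Analysis.Analysis" "HOL-Computational_Algebra.Polynomial"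
begin

fun chebT :: "nat \<Rightarrow> real poly" where
  "chebT 0 = 1"
| "chebT (Suc 0) = [:0, 1:]"
| "chebT (Suc (Suc n)) = [:0, 2:] * chebT (Suc n) - chebT n"

definition rkc_w0 :: "nat \<Rightarrow> real \<Rightarrow> real" where
  "rkc_w0 s \<eta> = 1 + \<eta> / (real s)\<^sup>2"

definition rkc_T :: "nat \<Rightarrow> real \<Rightarrow> nat \<Rightarrow> real" where
  "rkc_T s \<eta> j = poly (chebT j) (rkc_w0 s \<eta>)"

definition rkc_T' :: "nat \<Rightarrow> real \<Rightarrow> nat \<Rightarrow> real" where
  "rkc_T' s \<eta> j = poly (pderiv (chebT j)) (rkc_w0 s \<eta>)"

definition rkc_T'' :: "nat \<Rightarrow> real \<Rightarrow> nat \<Rightarrow> real" where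
  "rkc_T'' s \<eta> j = poly (pderiv (pderiv (chebT j))) (rkc_w0 s \<eta>)"

definition rkc_w1 :: "nat \<Rightarrow> real \<Rightarrow> real" where
  "rkc_w1 s \<eta> = rkc_T' s \<eta> s / rkc_T'' s \<eta> s"

text \<open>The use of \<^term>\<open>max 2 j\<close> encodes the convention $b_0 = b_1 = b_2$.\<close>

definition rkc_b :: "nat \<Rightarrow> real \<Rightarrow> nat \<Rightarrow> real" where
  "rkc_b s \<eta> j = rkc_T'' s \<eta> (max 2 j) / (rkc_T' s \<eta> (max 2 j))\<^sup>2"

definition rkc_ut :: "nat \<Rightarrow> real \<Rightarrow> nat \<Rightarrow> real" where
  "rkc_ut s \<eta> j =
     (if j = 1 then rkc_w1 s \<eta> * rkc_b s \<eta> 1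
      else 2 * rkc_w1 s \<eta> * (rkc_b s \<eta> j / rkc_b s \<eta> (j - 1)))"

definition rkc_u :: "nat \<Rightarrow> real \<Rightarrow> nat \<Rightarrow> real" where
  "rkc_u s \<eta> j = 2 * rkc_w0 s \<eta> * (rkc_b s \<eta> j / rkc_b s \<eta> (j - 1))"

definition rkc_v :: "nat \<Rightarrow> real \<Rightarrow> nat \<Rightarrow> real" where
  "rkc_v s \<eta> j = - (rkc_b s \<eta> j / rkc_b s \<eta> (j - 2))"

definition rkc_gt :: "nat \<Rightarrow> real \<Rightarrow> nat \<Rightarrow> real" where
  "rkc_gt s \<eta> j = - (1 - rkc_b s \<eta> (j - 1) * rkc_T s \<eta> (j - 1)) * rkc_ut s \<eta> j"

text \<open>The stages $\hat K_i$.\<close>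

primrec prkc_pre :: "nat \<Rightarrow> ('a \<Rightarrow> 'a) \<Rightarrow> real \<Rightarrow> 'a \<Rightarrow> nat \<Rightarrow> 'a::real_vector" where
  "prkc_pre m fA h y 0 = y"
| "prkc_pre m fA h y (Suc i) =
     prkc_pre m fA h y i + (h / (2 * real m)) *\<^sub>R fA (prkc_pre m fA h y i)"

text \<open>The stages $K_0, \dots, K_s$, with starting value \<^term>\<open>K0\<close>.\<close>

fun prkc_mid :: "nat \<Rightarrow> real \<Rightarrow> ('a \<Rightarrow> 'a) \<Rightarrow> real \<Rightarrow> 'a \<Rightarrow> nat \<Rightarrow> 'a::real_vector" where
  "prkc_mid s \<eta> fD h K0 0 = K0"
| "prkc_mid s \<eta> fD h K0 (Suc 0) = K0 + (rkc_ut s \<eta> 1 * h) *\<^sub>R fD K0"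
| "prkc_mid s \<eta> fD h K0 (Suc (Suc i)) =
     (let j = i + 2 in
        rkc_u s \<eta> j *\<^sub>R prkc_mid s \<eta> fD h K0 (Suc i)
      + rkc_v s \<eta> j *\<^sub>R prkc_mid s \<eta> fD h K0 i
      + (1 - rkc_u s \<eta> j - rkc_v s \<eta> j) *\<^sub>R K0
      + (rkc_ut s \<eta> j * h) *\<^sub>R fD (prkc_mid s \<eta> fD h K0 (Suc i))
      + (rkc_gt s \<eta> j * h) *\<^sub>R fD K0)"

text \<open>\<^term>\<open>prkc_post m fA h Ks i\<close> is the stage $K_{s+3i}$ computed from \<^term>\<open>Ks\<close> $= K_s$; in the
  recursion, \<open>K\<close>, \<open>K'\<close>, \<open>K''\<close> stand for $K_{s+3i-3}$, $K_{s+3i-2}$, $K_{s+3i-1}$.\<close>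

primrec prkc_post :: "nat \<Rightarrow> ('a \<Rightarrow> 'a) \<Rightarrow> real \<Rightarrow> 'a \<Rightarrow> nat \<Rightarrow> 'a::real_vector" where
  "prkc_post m fA h Ks 0 = Ks"
| "prkc_post m fA h Ks (Suc i) =
     (let K = prkc_post m fA h Ks i;
          K' = K + (h / (6 * real m)) *\<^sub>R fA K;
          K'' = K - (h / (6 * real m)) *\<^sub>R fA K'
      in K + (2 * h / real m) *\<^sub>R fA K - (3 * h / (2 * real m)) *\<^sub>R fA K'')"

definition prkc_step ::
    "nat \<Rightarrow> nat \<Rightarrow> real \<Rightarrow> ('a \<Rightarrow> 'a) \<Rightarrow> ('a \<Rightarrow> 'a) \<Rightarrow> real \<Rightarrow> 'a \<Rightarrow> 'a::real_vector" where
  "prkc_step s m \<eta> fD fA h y =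
     prkc_post m fA h (prkc_mid s \<eta> fD h (prkc_pre m fA h y m) s) m"

text \<open>Class $C^k$ on the whole space. In finite dimension, continuity of all iterated directional
  derivatives is continuity of the iterated Frechet derivatives.\<close>

primrec C_k :: "nat \<Rightarrow> ('a::euclidean_space \<Rightarrow> 'b::real_normed_vector) \<Rightarrow> bool" where
  "C_k 0 f \<longleftrightarrow> continuous_on UNIV f"
| "C_k (Suc k) f \<longleftrightarrow>
     (\<forall>x. f differentiable (at x)) \<and> (\<forall>v. C_k k (\<lambda>x. frechet_derivative f (at x) v))"

definition ivp_solution ::
    "('a::real_normed_vector \<Rightarrow> 'a) \<Rightarrow> real \<Rightarrow> real \<Rightarrow> 'a \<Rightarrow> (real \<Rightarrow> 'a) \<Rightarrow> bool" where
  "ivp_solution F t0 T a y \<longleftrightarrow>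
     y t0 = a \<and> (\<forall>t\<in>{t0..T}. (y has_vector_derivative F (y t)) (at t within {t0..T}))"

text \<open>The one-step method \<open>\<Phi>\<close> maps a step size and a value to the next value. The local error is
  $O(h^{p+1})$ uniformly in the starting time \<open>t\<close> of the step; this covers both a fixed \<open>t\<close> and
  grid points $t_n$ that move with \<open>h\<close>.\<close>

definition consistent_of_order ::
    "nat \<Rightarrow> (real \<Rightarrow> 'a \<Rightarrow> 'a) \<Rightarrow> ('a::real_normed_vector \<Rightarrow> 'a) \<Rightarrow> real \<Rightarrow> real \<Rightarrow> 'a \<Rightarrow> bool" where
  "consistent_of_order p \<Phi> F t0 T a \<longleftrightarrow>
     (\<forall>y. ivp_solution F t0 T a y \<longrightarrow>
       (\<exists>C h0. h0 > 0 \<and>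
         (\<forall>h t. 0 < h \<and> h < h0 \<and> t0 \<le> t \<and> t + h \<le> T \<longrightarrow>
            norm (y (t + h) - \<Phi> h (y t)) \<le> C * h ^ (p + 1))))"

end

theory Submission
  imports Defs
begin

text \<open>All stages are expanded in powers of \<open>h\<close> around \<open>y(t)\<close>. If a stage is
  \<open>y + h p + h\<^sup>2 q + O(h\<^sup>3)\<close>, then \<open>h f\<close> of it is \<open>h f(y) + h\<^sup>2 f'(y) p + O(h\<^sup>3)\<close>. The Chebyshev
  stages contribute \<open>h c\<^sub>j f\<^sub>D + h\<^sup>2 d\<^sub>j f\<^sub>D' f\<^sub>D\<close> with \<open>c\<^sub>j = b\<^sub>j \<omega>\<^sub>1 T\<^sub>j'(\<omega>\<^sub>0)\<close> and
  \<open>d\<^sub>j = b\<^sub>j \<omega>\<^sub>1\<^sup>2 T\<^sub>j''(\<omega>\<^sub>0) / 2\<close>: the recursions for \<open>c\<^sub>j\<close> and \<open>d\<^sub>j\<close> are the first and second derivatives of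
  the three-term recurrence, and the choice of \<open>\<omega>\<^sub>1\<close> gives \<open>c\<^sub>s = 1\<close>, \<open>d\<^sub>s = 1/2\<close>. Neither half of the
  advection part is of second order: the coefficients of \<open>h\<^sup>2 f\<^sub>A' f\<^sub>A\<close> are \<open>(m-1)/(8m)\<close> before
  and \<open>(m+1)/(8m)\<close> after the Chebyshev stages instead of \<open>1/8\<close>, but the two errors cancel.\<close>

section \<open>Taylor estimates\<close>

text \<open>\<open>C_k\<close> controls a derivative only along one fixed direction at a time.
  Expanding v in the basis turns such directional bounds into a bound that is uniform in v.\<close>

lemma linear_norm_le_sum_Basis:
  fixes D :: "'a::euclidean_space \<Rightarrow> 'b::real_normed_vector"
  assumes "linear D" and "\<And>b. b \<in> Basis \<Longrightarrow> norm (D b) \<le> B b"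
  shows "norm (D v) \<le> (\<Sum>b\<in>Basis. B b) * norm v"
proof -
  have "D v = D (\<Sum>b\<in>Basis. (v \<bullet> b) *\<^sub>R b)"
    by (simp add: euclidean_representation)
  also have "\<dots> = (\<Sum>b\<in>Basis. (v \<bullet> b) *\<^sub>R D b)"
    by (simp add: assms(1) linear_sum linear_scale)
  finally have "norm (D v) \<le> (\<Sum>b\<in>Basis. norm ((v \<bullet> b) *\<^sub>R D b))"
    by (metis norm_sum)
  also have "\<dots> \<le> (\<Sum>b\<in>Basis. norm v * B b)"
    by (intro sum_mono) (auto intro!: mult_mono assms(2) Basis_le_norm)
  finally show ?thesis
    by (simp add: sum_distrib_left mult.commute)
qed

lemma continuous_on_cball_bound:
  fixes g :: "'a::euclidean_space \<Rightarrow> 'b::real_normed_vector"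
  assumes "continuous_on UNIV g"
  shows "\<exists>B\<ge>0. \<forall>x\<in>cball 0 R. norm (g x) \<le> B"
proof -
  have "bounded (g ` cball 0 R)"
    by (meson assms compact_cball compact_continuous_image compact_imp_bounded continuous_on_subset
        subset_UNIV)
  then show ?thesis
    by (auto simp: bounded_pos intro: less_imp_le)
qed

lemma differentiable_imp_continuous_on_UNIV:
  assumes "\<And>x. g differentiable (at x)"
  shows "continuous_on UNIV g"
  using assms by (simp add: continuous_at_imp_continuous_on differentiable_imp_continuous_within)

lemma C_1_frechet_derivative_bound:
  fixes g :: "'a::euclidean_space \<Rightarrow> 'b::real_normed_vector"
  assumes "\<And>x. g differentiable (at x)"
    and "\<And>v. continuous_on UNIV (\<lambda>x. frechet_derivative g (at x) v)"
  shows "\<exists>B\<ge>0. \<forall>x\<in>cball 0 R. \<forall>v. norm (frechet_derivative g (at x) v) \<le> B * norm v"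
proof -
  obtain B where B: "\<And>v. B v \<ge> 0"
      "\<And>v x. x \<in> cball 0 R \<Longrightarrow> norm (frechet_derivative g (at x) v) \<le> B v"
    using continuous_on_cball_bound[OF assms(2)] by metis
  have "norm (frechet_derivative g (at x) v) \<le> (\<Sum>b\<in>Basis. B b) * norm v" if "x \<in> cball 0 R" for x v
    using B that by (intro linear_norm_le_sum_Basis linear_frechet_derivative assms(1)) auto
  then show ?thesis
    using B(1) by (intro exI[of _ "\<Sum>b\<in>Basis. B b"]) (auto intro: sum_nonneg)
qed

text \<open>Mean value inequality on the convex ball, where the derivative is bounded by
  compactness.\<close>

lemma C_1_lipschitz:
  fixes g :: "'a::euclidean_space \<Rightarrow> 'b::real_normed_vector"
  assumes "C_k 1 g"
  shows "\<exists>L\<ge>0. \<forall>x\<in>cball 0 R. \<forall>z\<in>cball 0 R. norm (g z - g x) \<le> L * norm (z - x)"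
proof -
  have diff: "\<And>x. g differentiable (at x)"
    and "\<And>v. continuous_on UNIV (\<lambda>x. frechet_derivative g (at x) v)"
    using assms by auto
  then obtain B where B: "B \<ge> 0"
      "\<And>x v. x \<in> cball 0 R \<Longrightarrow> norm (frechet_derivative g (at x) v) \<le> B * norm v"
    using C_1_frechet_derivative_bound by metis
  have "norm (g z - g x) \<le> B * norm (z - x)" if "x \<in> cball 0 R" "z \<in> cball 0 R" for x z
  proof (rule differentiable_bound[where S = "cball 0 R" and f' = "\<lambda>x. frechet_derivative g (at x)"])
    show "(g has_derivative frechet_derivative g (at u)) (at u within cball 0 R)" for u
      using diff by (simp add: frechet_derivative_works has_derivative_at_withinI)
    show "onorm (frechet_derivative g (at u)) \<le> B" if "u \<in> cball 0 R" for u
      using B(2)[OF that] by (rule onorm_le)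
  qed (use that in auto)
  then show ?thesis
    using B(1) by blast
qed

lemma C_2_differentiable:
  assumes "C_k 2 f"
  shows "f differentiable (at x)" "C_k 1 (\<lambda>x. frechet_derivative f (at x) v)"
  using assms by (auto simp: numeral_2_eq_2)

text \<open>The linearisation error is at most |z - x| times the oscillation of the derivative along
  the segment from x to z, and the derivative is Lipschitz in each basis direction.\<close>

lemma C_2_taylor:
  fixes f :: "'a::euclidean_space \<Rightarrow> 'b::real_normed_vector"
  assumes "C_k 2 f"
  shows "\<exists>C\<ge>0. \<forall>x\<in>cball 0 R. \<forall>z\<in>cball 0 R.
    norm (f z - f x - frechet_derivative f (at x) (z - x)) \<le> C * (norm (z - x))\<^sup>2"
proof -
  let ?f' = "\<lambda>x. frechet_derivative f (at x)"
  obtain L where L: "\<And>v. L v \<ge> 0"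
      "\<And>v x z. x \<in> cball 0 R \<Longrightarrow> z \<in> cball 0 R \<Longrightarrow> norm (?f' z v - ?f' x v) \<le> L v * norm (z - x)"
    using C_1_lipschitz[OF C_2_differentiable(2)[OF assms]] by metis
  let ?C = "\<Sum>b\<in>Basis. L b"
  have *: "norm (f z - f x - ?f' x (z - x)) \<le> ?C * (norm (z - x))\<^sup>2"
    if xz: "x \<in> cball 0 R" "z \<in> cball 0 R" for x z
  proof -
    have sub: "closed_segment x z \<subseteq> cball 0 R"
      using xz by (simp add: closed_segment_subset)
    have "norm (f z - f x - ?f' x (z - x)) \<le> norm (z - x) * (?C * norm (z - x))"
    proof (rule differentiable_bound_linearization[where S = "closed_segment x z"])
      show "x + t *\<^sub>R (z - x) \<in> closed_segment x z" if "t \<in> {0..1}" for t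
        using that by (auto simp: in_segment algebra_simps intro!: exI[of _ t])
      show "(f has_derivative ?f' u) (at u within closed_segment x z)" for u
        using C_2_differentiable(1)[OF assms]
        by (simp add: frechet_derivative_works has_derivative_at_withinI)
      show "onorm (?f' u - ?f' x) \<le> ?C * norm (z - x)" if u: "u \<in> closed_segment x z" for u
        unfolding fun_diff_def
      proof (rule onorm_le)
        fix v
        have "norm (?f' u v - ?f' x v) \<le> (\<Sum>b\<in>Basis. L b * norm (z - x)) * norm v"
        proof (rule linear_norm_le_sum_Basis)
          show "linear (\<lambda>v. ?f' u v - ?f' x v)"
            by (intro linear_compose_sub linear_frechet_derivative C_2_differentiable(1) assms)
          fix b :: 'a
          \<comment> \<open>The Lipschitz estimate applies on the segment because it stays inside
            the ball, and u is no farther from x than z is.\<close>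
          have "norm (?f' u b - ?f' x b) \<le> L b * norm (u - x)"
            using L(2) xz u sub by blast
          also have "\<dots> \<le> L b * norm (z - x)"
            using segment_bound(1)[OF u] L(1) by (simp add: mult_left_mono norm_minus_commute)
          finally show "norm (?f' u b - ?f' x b) \<le> L b * norm (z - x)" .
        qed
        then show "norm (?f' u v - ?f' x v) \<le> ?C * norm (z - x) * norm v"
          by (simp add: sum_distrib_right)
      qed
    qed auto
    then show ?thesis
      by (simp add: power2_eq_square mult_ac)
  qed
  show ?thesis
    using * L(1) by (intro exI[of _ ?C]) (auto intro: sum_nonneg)
qed

section \<open>Uniform order symbols\<close>

text \<open>The parameter x may range over a set that depends on h. In the application x is the
  starting time of the step, and D says that the step stays inside [t0, T].\<close>

definition unif_bigo :: "(real \<Rightarrow> 'b \<Rightarrow> bool) \<Rightarrow> nat \<Rightarrow> (real \<Rightarrow> 'b \<Rightarrow> 'a::real_normed_vector) \<Rightarrow> bool"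
  where "unif_bigo D n r \<longleftrightarrow>
    (\<exists>C. eventually (\<lambda>h. \<forall>x. D h x \<longrightarrow> norm (r h x) \<le> C * h ^ n) (at_right 0))"

lemma unif_bigoI:
  assumes "eventually (\<lambda>h. \<forall>x. D h x \<longrightarrow> norm (r h x) \<le> C * h ^ n) (at_right 0)"
  shows "unif_bigo D n r"
  using assms unif_bigo_def by blast

lemma eventually_at_right_0_pos: "eventually (\<lambda>h. 0 < (h::real)) (at_right 0)"
  by (rule eventually_at_right_less)

lemma unif_bigoE:
  assumes "unif_bigo D n r"
  obtains C where "C \<ge> 0" "eventually (\<lambda>h. 0 < h \<and> (\<forall>x. D h x \<longrightarrow> norm (r h x) \<le> C * h ^ n)) (at_right 0)"
proof -
  obtain C where C: "eventually (\<lambda>h. \<forall>x. D h x \<longrightarrow> norm (r h x) \<le> C * h ^ n) (at_right 0)"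
    using assms unif_bigo_def by blast
  have "eventually (\<lambda>h. 0 < h \<and> (\<forall>x. D h x \<longrightarrow> norm (r h x) \<le> \<bar>C\<bar> * h ^ n)) (at_right 0)"
    using C eventually_at_right_0_pos
  proof eventually_elim
    case (elim h)
    have "C * h ^ n \<le> \<bar>C\<bar> * h ^ n"
      using elim by (intro mult_right_mono) auto
    then show ?case
      using elim by (meson order.trans)
  qed
  then show ?thesis
    using that[of "\<bar>C\<bar>"] by simp
qed

lemma unif_bigo_add:
  assumes "unif_bigo D n r" "unif_bigo D n r'"
  shows "unif_bigo D n (\<lambda>h x. r h x + r' h x)"
proof -
  obtain C where C: "eventually (\<lambda>h. 0 < h \<and> (\<forall>x. D h x \<longrightarrow> norm (r h x) \<le> C * h ^ n)) (at_right 0)"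
    using assms(1) by (rule unif_bigoE)
  obtain C' where C': "eventually (\<lambda>h. 0 < h \<and> (\<forall>x. D h x \<longrightarrow> norm (r' h x) \<le> C' * h ^ n)) (at_right 0)"
    using assms(2) by (rule unif_bigoE)
  show ?thesis
    by (rule unif_bigoI[where C = "C + C'"], use C C' in eventually_elim)
      (auto simp: distrib_right intro!: order.trans[OF norm_triangle_ineq] add_mono)
qed

lemma unif_bigo_scaleR:
  assumes "unif_bigo D n r"
  shows "unif_bigo D n (\<lambda>h x. c *\<^sub>R r h x)"
proof -
  obtain C where C: "eventually (\<lambda>h. 0 < h \<and> (\<forall>x. D h x \<longrightarrow> norm (r h x) \<le> C * h ^ n)) (at_right 0)"
    using assms(1) by (rule unif_bigoE)
  show ?thesis
    by (rule unif_bigoI[where C = "\<bar>c\<bar> * C"], use C in eventually_elim)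
      (auto simp: mult.assoc intro!: mult_left_mono)
qed

lemma unif_bigo_diff:
  assumes "unif_bigo D n r" "unif_bigo D n r'"
  shows "unif_bigo D n (\<lambda>h x. r h x - r' h x)"
  using unif_bigo_add[OF assms(1) unif_bigo_scaleR[OF assms(2), of "-1"]] by simp

lemma unif_bigo_times_h:
  assumes "unif_bigo D n r"
  shows "unif_bigo D (n + k) (\<lambda>h x. h ^ k *\<^sub>R r h x)"
proof -
  obtain C where C: "eventually (\<lambda>h. 0 < h \<and> (\<forall>x. D h x \<longrightarrow> norm (r h x) \<le> C * h ^ n)) (at_right 0)"
    using assms(1) by (rule unif_bigoE)
  show ?thesis
    by (rule unif_bigoI[where C = C], use C in eventually_elim)
      (auto simp: power_add mult_ac)
qed

lemma unif_bigo_mono: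
  assumes "unif_bigo D n r" "k \<le> n"
  shows "unif_bigo D k r"
proof -
  obtain C where C: "C \<ge> 0"
    "eventually (\<lambda>h. 0 < h \<and> (\<forall>x. D h x \<longrightarrow> norm (r h x) \<le> C * h ^ n)) (at_right 0)"
    using assms(1) by (rule unif_bigoE)
  have "eventually (\<lambda>h::real. h < 1) (at_right 0)"
    by (rule eventually_at_right_real[THEN eventually_mono]) auto
  with C(2) have "eventually (\<lambda>h. \<forall>x. D h x \<longrightarrow> norm (r h x) \<le> C * h ^ k) (at_right 0)"
  proof eventually_elim
    case (elim h)
    have "C * h ^ n \<le> C * h ^ k"
      using elim assms(2) C(1) by (intro mult_left_mono power_decreasing) auto
    then show ?case
      using elim by (meson order.trans)
  qed
  then show ?thesis
    by (rule unif_bigoI)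
qed

lemma unif_bigo_cong:
  assumes "unif_bigo D n r" "\<And>h x. D h x \<Longrightarrow> r h x = r' h x"
  shows "unif_bigo D n r'"
  using assms by (simp add: unif_bigo_def)

text \<open>Order \<open>0\<close> expresses boundedness for small \<open>h\<close>.\<close>

lemma unif_bigo_0_iff:
  "unif_bigo D 0 r \<longleftrightarrow> (\<exists>C. eventually (\<lambda>h. \<forall>x. D h x \<longrightarrow> norm (r h x) \<le> C) (at_right 0))"
  by (simp add: unif_bigo_def)

text \<open>For small h the base points lie in one ball, on which the derivatives are uniformly
  bounded linear maps, so the order of r is inherited.\<close>

lemma unif_bigo_frechet_derivative:
  fixes f :: "'a::euclidean_space \<Rightarrow> 'c::real_normed_vector"
  assumes "C_k 2 f" "unif_bigo D 0 g" "unif_bigo D n r"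
  shows "unif_bigo D n (\<lambda>h x. frechet_derivative f (at (g h x)) (r h x))"
proof -
  obtain R where R: "eventually (\<lambda>h. \<forall>x. D h x \<longrightarrow> norm (g h x) \<le> R) (at_right 0)"
    using assms(2) unif_bigo_0_iff by blast
  obtain C where C: "eventually (\<lambda>h. 0 < h \<and> (\<forall>x. D h x \<longrightarrow> norm (r h x) \<le> C * h ^ n)) (at_right 0)"
    using assms(3) by (rule unif_bigoE)
  have "continuous_on UNIV (\<lambda>x. frechet_derivative f (at x) v)" for v
    using C_2_differentiable(2)[OF assms(1)] by (intro differentiable_imp_continuous_on_UNIV) auto
  then obtain B where B: "B \<ge> 0"
      "\<And>x v. x \<in> cball 0 R \<Longrightarrow> norm (frechet_derivative f (at x) v) \<le> B * norm v"
    using C_1_frechet_derivative_bound[OF C_2_differentiable(1)[OF assms(1)]] by metis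
  show ?thesis
  proof (rule unif_bigoI[where C = "B * C"], use R C in eventually_elim, intro allI impI)
    fix h x
    assume "\<forall>x. D h x \<longrightarrow> norm (g h x) \<le> R" "0 < h \<and> (\<forall>x. D h x \<longrightarrow> norm (r h x) \<le> C * h ^ n)" "D h x"
    then have "g h x \<in> cball 0 R" and r: "norm (r h x) \<le> C * h ^ n"
      by auto
    then have "norm (frechet_derivative f (at (g h x)) (r h x)) \<le> B * norm (r h x)"
      using B(2) by blast
    also have "\<dots> \<le> B * (C * h ^ n)"
      using r B(1) by (rule mult_left_mono)
    finally show "norm (frechet_derivative f (at (g h x)) (r h x)) \<le> B * C * h ^ n"
      by (simp add: mult.assoc)
  qed
qed

lemma unif_bigo_compose_bounded:
  fixes f :: "'a::euclidean_space \<Rightarrow> 'c::real_normed_vector"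
  assumes "continuous_on UNIV f" "unif_bigo D 0 g"
  shows "unif_bigo D 0 (\<lambda>h x. f (g h x))"
proof -
  obtain R where R: "eventually (\<lambda>h. \<forall>x. D h x \<longrightarrow> norm (g h x) \<le> R) (at_right 0)"
    using assms(2) unif_bigo_0_iff by blast
  obtain B where B: "\<And>x. x \<in> cball 0 R \<Longrightarrow> norm (f x) \<le> B"
    using continuous_on_cball_bound[OF assms(1)] by blast
  show ?thesis
    unfolding unif_bigo_0_iff
    by (rule exI[of _ B], use R in eventually_elim) (use B in auto)
qed

lemma C_2_unif_bigo_taylor:
  fixes f :: "'a::euclidean_space \<Rightarrow> 'c::real_normed_vector"
  assumes "C_k 2 f" "unif_bigo D 0 Y" "unif_bigo D 1 (\<lambda>h x. g h x - Y h x)"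
  shows "unif_bigo D 2 (\<lambda>h x. f (g h x) - f (Y h x) - frechet_derivative f (at (Y h x)) (g h x - Y h x))"
proof -
  \<comment> \<open>One ball must contain both \<open>Y\<close> and \<open>g\<close> before the
    Taylor estimate gives a uniform constant.\<close>
  have "unif_bigo D 0 g"
    using unif_bigo_add[OF assms(2) unif_bigo_mono[OF assms(3), of 0]] by simp
  then obtain S where S: "eventually (\<lambda>h. \<forall>x. D h x \<longrightarrow> norm (g h x) \<le> S) (at_right 0)"
    using unif_bigo_0_iff by blast
  obtain R where R: "eventually (\<lambda>h. \<forall>x. D h x \<longrightarrow> norm (Y h x) \<le> R) (at_right 0)"
    using assms(2) unif_bigo_0_iff by blast
  obtain C where C: "eventually (\<lambda>h. 0 < h \<and> (\<forall>x. D h x \<longrightarrow> norm (g h x - Y h x) \<le> C * h ^ 1)) (at_right 0)"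
    using assms(3) by (rule unif_bigoE)
  obtain B where B: "B \<ge> 0"
      "\<And>x z. x \<in> cball 0 (max R S) \<Longrightarrow> z \<in> cball 0 (max R S) \<Longrightarrow>
        norm (f z - f x - frechet_derivative f (at x) (z - x)) \<le> B * (norm (z - x))\<^sup>2"
    using C_2_taylor[OF assms(1), of "max R S"] by blast
  show ?thesis
  proof (rule unif_bigoI[where C = "B * C\<^sup>2"], use S R C in eventually_elim, intro allI impI)
    fix h x
    assume *: "\<forall>x. D h x \<longrightarrow> norm (g h x) \<le> S" "\<forall>x. D h x \<longrightarrow> norm (Y h x) \<le> R"
      "0 < h \<and> (\<forall>x. D h x \<longrightarrow> norm (g h x - Y h x) \<le> C * h ^ 1)" "D h x"
    then have r: "norm (g h x - Y h x) \<le> C * h"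
      by auto
    have "Y h x \<in> cball 0 (max R S)" "g h x \<in> cball 0 (max R S)"
      using * by (auto simp: le_max_iff_disj)
    then have "norm (f (g h x) - f (Y h x) - frechet_derivative f (at (Y h x)) (g h x - Y h x))
        \<le> B * (norm (g h x - Y h x))\<^sup>2"
      by (rule B(2))
    also have "\<dots> \<le> B * (C * h)\<^sup>2"
      using r B(1) by (intro mult_left_mono power_mono) auto
    finally show "norm (f (g h x) - f (Y h x) - frechet_derivative f (at (Y h x)) (g h x - Y h x))
        \<le> B * C\<^sup>2 * h\<^sup>2"
      by (simp add: power_mult_distrib mult.assoc)
  qed
qed

lemma C_2_unif_bigo_expansion:
  fixes f :: "'a::euclidean_space \<Rightarrow> 'c::real_normed_vector"
  assumes "C_k 2 f" "unif_bigo D 0 Y" "unif_bigo D 0 p"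
    and "unif_bigo D 2 (\<lambda>h x. g h x - (Y h x + h *\<^sub>R p h x))"
  shows "unif_bigo D 2 (\<lambda>h x. f (g h x) - (f (Y h x) + h *\<^sub>R frechet_derivative f (at (Y h x)) (p h x)))"
proof -
  let ?f' = "\<lambda>x. frechet_derivative f (at x)"
  have "unif_bigo D 1 (\<lambda>h x. (g h x - (Y h x + h *\<^sub>R p h x)) + h *\<^sub>R p h x)"
    using unif_bigo_times_h[OF assms(3), of 1]
    by (intro unif_bigo_add unif_bigo_mono[OF assms(4), of 1]) auto
  then have "unif_bigo D 1 (\<lambda>h x. g h x - Y h x)"
    by simp
  from C_2_unif_bigo_taylor[OF assms(1,2) this]
  \<comment> \<open>The increment g - Y is h p plus a term of order h^2. Adding back the derivative
    of that second term leaves exactly h f'(Y) p.\<close>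
  have "unif_bigo D 2 (\<lambda>h x. (f (g h x) - f (Y h x) - ?f' (Y h x) (g h x - Y h x))
      + ?f' (Y h x) (g h x - (Y h x + h *\<^sub>R p h x)))"
    by (rule unif_bigo_add) (rule unif_bigo_frechet_derivative[OF assms(1,2,4)])
  then show ?thesis
  proof (rule unif_bigo_cong)
    fix h x
    have lin: "linear (?f' (Y h x))"
      by (intro linear_frechet_derivative C_2_differentiable(1) assms(1))
    show "f (g h x) - f (Y h x) - ?f' (Y h x) (g h x - Y h x) + ?f' (Y h x) (g h x - (Y h x + h *\<^sub>R p h x))
      = f (g h x) - (f (Y h x) + h *\<^sub>R ?f' (Y h x) (p h x))"
      by (simp add: linear_diff[OF lin] linear_add[OF lin] linear_scale[OF lin])
  qed
qed

section \<open>Second-order expansions\<close>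

text \<open>The coefficients depend on the starting value only, not on h. Their boundedness is part
  of the notion so that it is available whenever the expansion is inserted into f.\<close>

definition expands2 :: "(real \<Rightarrow> 'b \<Rightarrow> bool) \<Rightarrow> (real \<Rightarrow> 'b \<Rightarrow> 'a::real_normed_vector) \<Rightarrow>
    ('b \<Rightarrow> 'a) \<Rightarrow> ('b \<Rightarrow> 'a) \<Rightarrow> ('b \<Rightarrow> 'a) \<Rightarrow> bool"
  where "expands2 D g Y p q \<longleftrightarrow>
    unif_bigo D 0 (\<lambda>h. Y) \<and> unif_bigo D 0 (\<lambda>h. p) \<and> unif_bigo D 0 (\<lambda>h. q) \<and>
    unif_bigo D 3 (\<lambda>h x. g h x - (Y x + h *\<^sub>R p x + h\<^sup>2 *\<^sub>R q x))"

lemma expands2_add: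
  assumes "expands2 D g Y p q" "expands2 D g' Y' p' q'"
  shows "expands2 D (\<lambda>h x. g h x + g' h x) (\<lambda>x. Y x + Y' x) (\<lambda>x. p x + p' x) (\<lambda>x. q x + q' x)"
proof -
  have "unif_bigo D 3 (\<lambda>h x. (g h x - (Y x + h *\<^sub>R p x + h\<^sup>2 *\<^sub>R q x))
      + (g' h x - (Y' x + h *\<^sub>R p' x + h\<^sup>2 *\<^sub>R q' x)))"
    using assms unfolding expands2_def by (intro unif_bigo_add) auto
  then have "unif_bigo D 3 (\<lambda>h x. (g h x + g' h x)
      - ((Y x + Y' x) + h *\<^sub>R (p x + p' x) + h\<^sup>2 *\<^sub>R (q x + q' x)))"
    by (rule unif_bigo_cong) (simp add: algebra_simps)
  then show ?thesis
    using assms unfolding expands2_def by (auto intro: unif_bigo_add)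
qed

lemma expands2_scaleR:
  assumes "expands2 D g Y p q"
  shows "expands2 D (\<lambda>h x. c *\<^sub>R g h x) (\<lambda>x. c *\<^sub>R Y x) (\<lambda>x. c *\<^sub>R p x) (\<lambda>x. c *\<^sub>R q x)"
proof -
  have "unif_bigo D 3 (\<lambda>h x. c *\<^sub>R (g h x - (Y x + h *\<^sub>R p x + h\<^sup>2 *\<^sub>R q x)))"
    using assms unfolding expands2_def by (intro unif_bigo_scaleR) auto
  then have "unif_bigo D 3 (\<lambda>h x. c *\<^sub>R g h x - (c *\<^sub>R Y x + h *\<^sub>R c *\<^sub>R p x + h\<^sup>2 *\<^sub>R c *\<^sub>R q x))"
    by (rule unif_bigo_cong) (simp add: algebra_simps)
  then show ?thesis
    using assms unfolding expands2_def by (auto intro: unif_bigo_scaleR)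
qed

text \<open>The factor h raises every order by one: the constant coefficient becomes 0, and only Y
  and p of the inner expansion are visible, since h^2 q moves into the remainder.\<close>

lemma expands2_h_compose:
  fixes f :: "'a::euclidean_space \<Rightarrow> 'c::real_normed_vector"
  assumes "C_k 2 f" "expands2 D g Y p q"
  shows "expands2 D (\<lambda>h x. (c * h) *\<^sub>R f (g h x)) (\<lambda>x. 0) (\<lambda>x. c *\<^sub>R f (Y x))
    (\<lambda>x. c *\<^sub>R frechet_derivative f (at (Y x)) (p x))"
proof -
  let ?f' = "\<lambda>x. frechet_derivative f (at x)"
  have Y: "unif_bigo D 0 (\<lambda>h. Y)" and p: "unif_bigo D 0 (\<lambda>h. p)" and q: "unif_bigo D 0 (\<lambda>h. q)"
    and r: "unif_bigo D 3 (\<lambda>h x. g h x - (Y x + h *\<^sub>R p x + h\<^sup>2 *\<^sub>R q x))"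
    using assms(2) by (auto simp: expands2_def)
  have "unif_bigo D 2 (\<lambda>h x. (g h x - (Y x + h *\<^sub>R p x + h\<^sup>2 *\<^sub>R q x)) + h\<^sup>2 *\<^sub>R q x)"
    using unif_bigo_times_h[OF q, of 2, unfolded add_0_left] by (intro unif_bigo_add unif_bigo_mono[OF r]) auto
  then have "unif_bigo D 2 (\<lambda>h x. g h x - (Y x + h *\<^sub>R p x))"
    by (rule unif_bigo_cong) simp
  from unif_bigo_times_h[OF C_2_unif_bigo_expansion[OF assms(1) Y p this], of 1]
  have "unif_bigo D 3 (\<lambda>h x. h *\<^sub>R (f (g h x) - (f (Y x) + h *\<^sub>R ?f' (Y x) (p x))))"
    by (simp add: numeral_3_eq_3)
  then have "expands2 D (\<lambda>h x. h *\<^sub>R f (g h x)) (\<lambda>x. 0) (\<lambda>x. f (Y x)) (\<lambda>x. ?f' (Y x) (p x))"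
    using unif_bigo_compose_bounded[OF differentiable_imp_continuous_on_UNIV Y]
      unif_bigo_frechet_derivative[OF assms(1) Y p] C_2_differentiable(1)[OF assms(1)]
    by (auto simp: expands2_def power2_eq_square algebra_simps unif_bigo_0_iff)
  from expands2_scaleR[OF this, of c] show ?thesis
    by simp
qed

text \<open>Compound expansions come with unsimplified coefficients; this rule makes the
  identification of each coefficient a goal of its own.\<close>

lemma expands2_cong:
  assumes "expands2 D g Y p q" "\<And>h x. g h x = g' h x"
    "\<And>x. Y x = Y' x" "\<And>x. p x = p' x" "\<And>x. q x = q' x"
  shows "expands2 D g' Y' p' q'"
proof -
  have "g = g'" "Y = Y'" "p = p'" "q = q'"
    using assms by auto
  then show ?thesis
    using assms(1) by simp
qed

section \<open>Chebyshev coefficients\<close>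

text \<open>For x \<ge> 1 the recurrence gives T_(n+2) \<ge> 2 T_(n+1) - T_n, so the increments
  never decrease.\<close>

lemma chebT_increasing:
  fixes x :: real
  assumes "x \<ge> 1"
  shows "poly (chebT n) x > 0 \<and> poly (chebT (Suc n)) x \<ge> poly (chebT n) x"
proof (induction n)
  case (Suc n)
  have "1 * poly (chebT (Suc n)) x \<le> x * poly (chebT (Suc n)) x"
    using assms Suc by (intro mult_right_mono) auto
  moreover have "poly (chebT (Suc (Suc n))) x = 2 * (x * poly (chebT (Suc n)) x) - poly (chebT n) x"
    by simp
  ultimately show ?case
    using Suc by linarith
qed (use assms in auto)

lemma pderiv_chebT_Suc_Suc:
  "pderiv (chebT (Suc (Suc n))) = [:0, 2:] * pderiv (chebT (Suc n)) + 2 * chebT (Suc n) - pderiv (chebT n)"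
  by (simp add: pderiv_diff pderiv_mult pderiv_pCons pderiv_smult numeral_poly)

text \<open>The factor 2x and the summand 2 T_(n+1) each contribute 2 T'_(n+1), whence the
  4.\<close>

lemma pderiv_pderiv_chebT_Suc_Suc:
  "pderiv (pderiv (chebT (Suc (Suc n)))) =
    [:0, 2:] * pderiv (pderiv (chebT (Suc n))) + 4 * pderiv (chebT (Suc n)) - pderiv (pderiv (chebT n))"
proof -
  have "pderiv ([:0, 2:] :: real poly) = 2"
    by (simp add: pderiv_pCons numeral_poly)
  then show ?thesis
    unfolding pderiv_chebT_Suc_Suc pderiv_diff pderiv_add pderiv_mult by (simp del: mult_pCons_left)
qed

text \<open>The increment argument for T_n again; the extra summand 2 T_(n+1) > 0 makes the growth
  strict.\<close>

lemma pderiv_chebT_increasing: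
  fixes x :: real
  assumes "x \<ge> 1"
  shows "poly (pderiv (chebT n)) x \<ge> 0 \<and> poly (pderiv (chebT (Suc n))) x > poly (pderiv (chebT n)) x"
proof (induction n)
  case (Suc n)
  have "1 * poly (pderiv (chebT (Suc n))) x \<le> x * poly (pderiv (chebT (Suc n))) x"
    using assms Suc by (intro mult_right_mono) auto
  moreover have "poly (pderiv (chebT (Suc (Suc n)))) x =
      2 * (x * poly (pderiv (chebT (Suc n))) x) + 2 * poly (chebT (Suc n)) x - poly (pderiv (chebT n)) x"
    unfolding pderiv_chebT_Suc_Suc by simp
  ultimately show ?case
    using Suc chebT_increasing[OF assms, of "Suc n"] by linarith
qed (auto simp: pderiv_pCons)

text \<open>The indices start at 1 because T_0'' = T_1'' = 0: strict growth begins with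
  T_2''.\<close>

lemma pderiv_pderiv_chebT_increasing:
  fixes x :: real
  assumes "x \<ge> 1"
  shows "poly (pderiv (pderiv (chebT (Suc n)))) x \<ge> 0 \<and>
    poly (pderiv (pderiv (chebT (Suc (Suc n))))) x > poly (pderiv (pderiv (chebT (Suc n)))) x"
proof (induction n)
  case (Suc n)
  have "1 * poly (pderiv (pderiv (chebT (Suc (Suc n))))) x \<le> x * poly (pderiv (pderiv (chebT (Suc (Suc n))))) x"
    using assms Suc by (intro mult_right_mono) auto
  moreover have "poly (pderiv (pderiv (chebT (Suc (Suc (Suc n)))))) x =
      2 * (x * poly (pderiv (pderiv (chebT (Suc (Suc n))))) x) + 4 * poly (pderiv (chebT (Suc (Suc n)))) x
      - poly (pderiv (pderiv (chebT (Suc n)))) x"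
    unfolding pderiv_pderiv_chebT_Suc_Suc[of "Suc n"] by simp
  ultimately show ?case
    using Suc pderiv_chebT_increasing[OF assms, of "Suc n"] by linarith
qed (auto simp: pderiv_pCons pderiv_diff)

context
  fixes \<eta> :: real and s :: nat
  assumes \<eta>: "\<eta> \<ge> 0"
begin

lemma rkc_w0_ge_1: "rkc_w0 s \<eta> \<ge> 1"
  using \<eta> by (simp add: rkc_w0_def)

lemma rkc_T'_pos: "j > 0 \<Longrightarrow> rkc_T' s \<eta> j > 0"
  using pderiv_chebT_increasing[OF rkc_w0_ge_1, of "j - 1"] by (simp add: rkc_T'_def)

lemma rkc_T''_pos: "j \<ge> 2 \<Longrightarrow> rkc_T'' s \<eta> j > 0"
  using pderiv_pderiv_chebT_increasing[OF rkc_w0_ge_1, of "j - 2"]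
  by (simp add: rkc_T''_def numeral_2_eq_2 Suc_diff_Suc)

text \<open>The convention b_0 = b_1 = b_2 gives positivity for every j, so the recursions may be
  cleared of the denominators b_(j-1) and b_(j-2).\<close>

lemma rkc_b_pos: "rkc_b s \<eta> j > 0"
  unfolding rkc_b_def by (intro divide_pos_pos zero_less_power rkc_T'_pos rkc_T''_pos) auto

definition rkc_c :: "nat \<Rightarrow> real"
  where "rkc_c j = rkc_b s \<eta> j * rkc_w1 s \<eta> * rkc_T' s \<eta> j"

definition rkc_d :: "nat \<Rightarrow> real"
  where "rkc_d j = rkc_b s \<eta> j * (rkc_w1 s \<eta>)\<^sup>2 * rkc_T'' s \<eta> j / 2"

lemma rkc_c_0: "rkc_c 0 = 0" and rkc_d_0: "rkc_d 0 = 0" and rkc_d_1: "rkc_d (Suc 0) = 0"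
  by (simp_all add: rkc_c_def rkc_d_def rkc_T'_def rkc_T''_def pderiv_pCons)

lemma rkc_c_1: "rkc_c (Suc 0) = rkc_ut s \<eta> 1"
  by (simp add: rkc_c_def rkc_ut_def rkc_T'_def pderiv_pCons)

text \<open>Since \<open>rkc_ut\<close> + \<open>rkc_gt\<close> at j+2 equals b_(j+1) T_(j+1)
  \<open>rkc_ut\<close> = 2 \<omega>_1 b_(j+2) T_(j+1), this is the recurrence for T' multiplied by
  \<omega>_1 b_(j+2).\<close>

lemma rkc_c_rec:
  "rkc_c (j + 2) = rkc_u s \<eta> (j + 2) * rkc_c (Suc j) + rkc_v s \<eta> (j + 2) * rkc_c j
    + rkc_ut s \<eta> (j + 2) + rkc_gt s \<eta> (j + 2)"
proof -
  have rec: "rkc_T' s \<eta> (j + 2) = 2 * rkc_w0 s \<eta> * rkc_T' s \<eta> (Suc j) + 2 * rkc_T s \<eta> (Suc j) - rkc_T' s \<eta> j"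
    by (simp add: rkc_T'_def rkc_T_def pderiv_chebT_Suc_Suc del: chebT.simps)
  have "rkc_b s \<eta> j \<noteq> 0" "rkc_b s \<eta> (Suc j) \<noteq> 0"
    using rkc_b_pos by (simp_all add: less_imp_neq[symmetric])
  then show ?thesis
    unfolding rkc_c_def rec
    by (simp add: rkc_u_def rkc_v_def rkc_ut_def rkc_gt_def field_simps)
qed

text \<open>The recurrence for T'' multiplied by \<omega>_1^2 b_(j+2) / 2; the summand 4 T'_(j+1)
  turns into \<open>rkc_ut\<close> times c_(j+1).\<close>

lemma rkc_d_rec:
  "rkc_d (j + 2) = rkc_u s \<eta> (j + 2) * rkc_d (Suc j) + rkc_v s \<eta> (j + 2) * rkc_d j
    + rkc_ut s \<eta> (j + 2) * rkc_c (Suc j)"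
proof -
  have rec: "rkc_T'' s \<eta> (j + 2) = 2 * rkc_w0 s \<eta> * rkc_T'' s \<eta> (Suc j) + 4 * rkc_T' s \<eta> (Suc j) - rkc_T'' s \<eta> j"
    using pderiv_pderiv_chebT_Suc_Suc[of j]
    by (simp add: rkc_T'_def rkc_T''_def del: chebT.simps)
  have "rkc_b s \<eta> j \<noteq> 0" "rkc_b s \<eta> (Suc j) \<noteq> 0"
    using rkc_b_pos by (simp_all add: less_imp_neq[symmetric])
  then show ?thesis
    unfolding rkc_c_def rkc_d_def rec
    by (simp add: rkc_u_def rkc_v_def rkc_ut_def field_simps power2_eq_square)
qed

lemma rkc_c_s: "s \<ge> 2 \<Longrightarrow> rkc_c s = 1"
  using rkc_T'_pos[of s] rkc_T''_pos[of s]
  by (simp add: rkc_c_def rkc_b_def rkc_w1_def max_def power2_eq_square)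

lemma rkc_d_s: "s \<ge> 2 \<Longrightarrow> rkc_d s = 1 / 2"
  using rkc_T'_pos[of s] rkc_T''_pos[of s]
  by (simp add: rkc_d_def rkc_b_def rkc_w1_def max_def power2_eq_square)

section \<open>Expansion of the stages\<close>

text \<open>The weights u_j, v_j and 1 - u_j - v_j sum to 1, so Y, p and q pass through unchanged.
  The term f'(p) is collected from both f evaluations, hence its coefficient obeys the recursion of
  c_j; f'(f) is collected only from the previous stage and follows that of d_j.\<close>

lemma expands2_prkc_mid:
  fixes f :: "'a::euclidean_space \<Rightarrow> 'a"
  assumes f: "C_k 2 f" and K0: "expands2 D K0 Y p q"
  shows "expands2 D (\<lambda>h x. prkc_mid s \<eta> f h (K0 h x) j) Y
    (\<lambda>x. p x + rkc_c j *\<^sub>R f (Y x))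
    (\<lambda>x. q x + rkc_c j *\<^sub>R frechet_derivative f (at (Y x)) (p x)
      + rkc_d j *\<^sub>R frechet_derivative f (at (Y x)) (f (Y x)))"
proof (induction j rule: induct_nat_012)
  case 0
  then show ?case
    using K0 by (simp add: rkc_c_0 rkc_d_0)
next
  case 1
  show ?case
    by (rule expands2_cong[OF expands2_add[OF K0 expands2_h_compose[OF f K0, of "rkc_ut s \<eta> 1"]]])
      (simp_all add: rkc_c_1 rkc_d_1)
next
  case (ge2 j)
  have lin: "linear (frechet_derivative f (at (Y x)))" for x
    by (intro linear_frechet_derivative C_2_differentiable(1) f)
  \<comment> \<open>The nesting reproduces the five summands of the stage recursion in their
    order.\<close>
  note step = expands2_add[OF expands2_add[OF expands2_add[OF expands2_add[OF
      expands2_scaleR[OF ge2(2), of "rkc_u s \<eta> (j + 2)"]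
      expands2_scaleR[OF ge2(1), of "rkc_v s \<eta> (j + 2)"]]
      expands2_scaleR[OF K0, of "1 - rkc_u s \<eta> (j + 2) - rkc_v s \<eta> (j + 2)"]]
      expands2_h_compose[OF f ge2(2), of "rkc_ut s \<eta> (j + 2)"]]
      expands2_h_compose[OF f K0, of "rkc_gt s \<eta> (j + 2)"]]
  have c: "rkc_c (Suc (Suc j)) = rkc_u s \<eta> (j + 2) * rkc_c (Suc j) + rkc_v s \<eta> (j + 2) * rkc_c j
      + rkc_ut s \<eta> (j + 2) + rkc_gt s \<eta> (j + 2)"
    using rkc_c_rec[of j] by simp
  have d: "rkc_d (Suc (Suc j)) = rkc_u s \<eta> (j + 2) * rkc_d (Suc j) + rkc_v s \<eta> (j + 2) * rkc_d j
      + rkc_ut s \<eta> (j + 2) * rkc_c (Suc j)"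
    using rkc_d_rec[of j] by simp
  show ?case
    by (rule expands2_cong[OF step], simp_all only: c d prkc_mid.simps Let_def
        linear_add[OF lin] linear_scale[OF lin])
      (simp_all add: algebra_simps)
qed

end

text \<open>These are i Euler steps of length h/(2m). Each pair of an earlier and a later step
  contributes 1/(4m^2) to f'(f), and there are i(i-1)/2 pairs.\<close>

lemma expands2_prkc_pre:
  fixes f :: "'a::euclidean_space \<Rightarrow> 'a"
  assumes f: "C_k 2 f" and Y: "unif_bigo D 0 (\<lambda>h. Y)"
  shows "expands2 D (\<lambda>h x. prkc_pre m f h (Y x) i) Y
    (\<lambda>x. (real i / (2 * real m)) *\<^sub>R f (Y x))
    (\<lambda>x. (real i * (real i - 1) / (8 * (real m)\<^sup>2)) *\<^sub>R frechet_derivative f (at (Y x)) (f (Y x)))"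
proof (induction i)
  case 0
  have "unif_bigo D 0 (\<lambda>h x. 0 :: 'a)" "unif_bigo D 3 (\<lambda>h x. 0 :: 'a)"
    by (auto intro!: unif_bigoI[where C = 0])
  then show ?case
    using Y by (simp add: expands2_def)
next
  case (Suc i)
  have lin: "linear (frechet_derivative f (at (Y x)))" for x
    by (intro linear_frechet_derivative C_2_differentiable(1) f)
  show ?case
  proof (rule expands2_cong[OF expands2_add[OF Suc expands2_h_compose[OF f Suc, of "1 / (2 * real m)"]]])
    fix x
    have "real (Suc i) * (real (Suc i) - 1) / (8 * (real m)\<^sup>2) =
        real i * (real i - 1) / (8 * (real m)\<^sup>2) + 1 / (2 * real m) * (real i / (2 * real m))"
      \<comment> \<open>For m = 0 all quotients are 0 by the convention for division.\<close>
      by (cases "m = 0") (auto simp: field_simps power2_eq_square)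
    then show "(real i * (real i - 1) / (8 * (real m)\<^sup>2)) *\<^sub>R frechet_derivative f (at (Y x)) (f (Y x)) +
        (1 / (2 * real m)) *\<^sub>R frechet_derivative f (at (Y x)) ((real i / (2 * real m)) *\<^sub>R f (Y x)) =
        (real (Suc i) * (real (Suc i) - 1) / (8 * (real m)\<^sup>2)) *\<^sub>R frechet_derivative f (at (Y x)) (f (Y x))"
      by (simp only: linear_scale[OF lin] scaleR_add_left scaleR_scaleR)
  qed (simp_all add: scaleR_add_left[symmetric] add_divide_distrib)
qed

text \<open>One round has total weight (2 - 3/2)/m = 1/(2m). Besides the pairs of rounds, each round
  contributes (3/(2m)) (1/(6m)) = 1/(4m^2) through \<open>K''\<close>, so that i(i-1)/2 becomes
  i(i+1)/2.\<close>

lemma expands2_prkc_post: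
  fixes f :: "'a::euclidean_space \<Rightarrow> 'a"
  assumes f: "C_k 2 f" and K: "expands2 D K Y p q"
  shows "expands2 D (\<lambda>h x. prkc_post m f h (K h x) i) Y
    (\<lambda>x. p x + (real i / (2 * real m)) *\<^sub>R f (Y x))
    (\<lambda>x. q x + (real i / (2 * real m)) *\<^sub>R frechet_derivative f (at (Y x)) (p x)
      + (real i * (real i + 1) / (8 * (real m)\<^sup>2)) *\<^sub>R frechet_derivative f (at (Y x)) (f (Y x)))"
proof (induction i)
  case 0
  show ?case
    using K by simp
next
  case (Suc i)
  have lin: "linear (frechet_derivative f (at (Y x)))" for x
    by (intro linear_frechet_derivative C_2_differentiable(1) f)
  \<comment> \<open>The facts follow the stages of one round. The zero constant coefficient of each
    h f term is the source of the \<open>Y x + 0\<close> in the goals below.\<close>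
  note K' = expands2_add[OF Suc expands2_h_compose[OF f Suc, of "1 / (6 * real m)"]]
  note K'' = expands2_add[OF Suc expands2_h_compose[OF f K', of "- (1 / (6 * real m))"]]
  note step = expands2_add[OF expands2_add[OF Suc expands2_h_compose[OF f Suc, of "2 / real m"]]
      expands2_h_compose[OF f K'', of "- (3 / (2 * real m))"]]
  show ?case
  proof (rule expands2_cong[OF step])
    fix x
    let ?f = "f (Y x)" and ?f' = "frechet_derivative f (at (Y x))"
    have c1: "real (Suc i) / (2 * real m) = real i / (2 * real m) + 2 / real m - 3 / (2 * real m)"
      by (cases "m = 0") (auto simp: field_simps)
    then show "p x + (real i / (2 * real m)) *\<^sub>R ?f + (2 / real m) *\<^sub>R ?f
        + (- (3 / (2 * real m))) *\<^sub>R f (Y x + 0)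
        = p x + (real (Suc i) / (2 * real m)) *\<^sub>R ?f"
      by (simp only: scaleR_add_left scaleR_diff_left scaleR_minus_left add_0_right) simp
    have c2: "real (Suc i) * (real (Suc i) + 1) / (8 * (real m)\<^sup>2) =
        real i * (real i + 1) / (8 * (real m)\<^sup>2) + 2 / real m * (real i / (2 * real m))
        - 3 / (2 * real m) * (real i / (2 * real m)) + 3 / (2 * real m) * (1 / (6 * real m))"
      by (cases "m = 0") (auto simp: field_simps power2_eq_square)
    show "q x + (real i / (2 * real m)) *\<^sub>R ?f' (p x) + (real i * (real i + 1) / (8 * (real m)\<^sup>2)) *\<^sub>R ?f' ?f
        + (2 / real m) *\<^sub>R ?f' (p x + (real i / (2 * real m)) *\<^sub>R ?f)
        + (- (3 / (2 * real m))) *\<^sub>R frechet_derivative f (at (Y x + 0))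
            (p x + (real i / (2 * real m)) *\<^sub>R ?f + (- (1 / (6 * real m))) *\<^sub>R f (Y x + 0))
        = q x + (real (Suc i) / (2 * real m)) *\<^sub>R ?f' (p x)
        + (real (Suc i) * (real (Suc i) + 1) / (8 * (real m)\<^sup>2)) *\<^sub>R ?f' ?f"
      by (simp only: c1 c2 add_0_right linear_add[OF lin] linear_scale[OF lin])
        (simp only: algebra_simps scaleR_scaleR scaleR_minus_left scaleR_minus_right minus_minus, simp)
  qed (simp_all add: Let_def)
qed

section \<open>Expansion of the exact solution\<close>

text \<open>The error of y vanishes at h = 0 and its derivative is the error of y', so the mean
  value inequality gains one order. Uniformity survives because every k in (0, h) is itself an
  admissible step size.\<close>

lemma unif_bigo_integrate:
  fixes y :: "real \<Rightarrow> 'a::euclidean_space"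
  assumes deriv: "\<And>t. t \<in> {t0..T} \<Longrightarrow> (y has_vector_derivative y' t) (at t within {t0..T})"
    and bigo: "unif_bigo (\<lambda>h t. t0 \<le> t \<and> t + h \<le> T) n (\<lambda>h t. y' (t + h) - (P t + h *\<^sub>R Q t))"
  shows "unif_bigo (\<lambda>h t. t0 \<le> t \<and> t + h \<le> T) (Suc n)
    (\<lambda>h t. y (t + h) - (y t + h *\<^sub>R P t + (h\<^sup>2 / 2) *\<^sub>R Q t))"
proof -
  obtain C where "C \<ge> 0" and "eventually (\<lambda>h. 0 < h \<and> (\<forall>t. t0 \<le> t \<and> t + h \<le> T \<longrightarrow>
      norm (y' (t + h) - (P t + h *\<^sub>R Q t)) \<le> C * h ^ n)) (at_right 0)"
    using bigo by (rule unif_bigoE)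
  then obtain h0 where h0: "h0 > 0" and C: "\<And>h t. 0 < h \<Longrightarrow> h < h0 \<Longrightarrow> t0 \<le> t \<Longrightarrow> t + h \<le> T \<Longrightarrow>
      norm (y' (t + h) - (P t + h *\<^sub>R Q t)) \<le> C * h ^ n"
    unfolding eventually_at_right_field by blast
  have "norm (y (t + h) - (y t + h *\<^sub>R P t + (h\<^sup>2 / 2) *\<^sub>R Q t)) \<le> C * h ^ Suc n"
    if h: "0 < h" "h < h0" and t: "t0 \<le> t" "t + h \<le> T" for h t
  proof -
    define r where "r \<equiv> \<lambda>k. y (t + k) - (y t + k *\<^sub>R P t + (k\<^sup>2 / 2) *\<^sub>R Q t)"
    define r' where "r' \<equiv> \<lambda>k. y' (t + k) - (P t + k *\<^sub>R Q t)"
    have yd: "((\<lambda>k. y (t + k)) has_vector_derivative y' (t + k)) (at k within {0..h})"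
      if "k \<in> {0..h}" for k
    proof -
      have "(y has_vector_derivative y' (t + k)) (at (t + k) within (+) t ` {0..h})"
        using that t by (intro has_vector_derivative_within_subset[OF deriv]) auto
      moreover have "((+) t has_vector_derivative 1) (at k within {0..h})"
        by (auto intro!: derivative_eq_intros)
      ultimately show ?thesis
        using vector_diff_chain_within[of "(+) t" 1 k "{0..h}" y "y' (t + k)"]
        by (simp add: o_def)
    qed
    have rd: "(r has_vector_derivative r' k) (at k within {0..h})" if "k \<in> {0..h}" for k
      unfolding r_def r'_def
      by (rule derivative_eq_intros yd that refl | simp)+
    have "\<exists>k\<in>{0<..<h}. norm (r h - r 0) \<le> norm ((\<lambda>v. v *\<^sub>R r' k) (h - 0))"
    proof (rule mvt_general)
      show "continuous_on {0..h} r"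
        using rd by (meson continuous_on_eq_continuous_within has_vector_derivative_continuous)
      fix k assume k: "0 < k" "k < h"
      \<comment> \<open>At interior points the derivative within the interval is the full
        derivative.\<close>
      then have "(r has_vector_derivative r' k) (at k)"
        using rd[of k] by (simp add: at_within_Icc_at)
      then show "(r has_derivative (\<lambda>v. v *\<^sub>R r' k)) (at k)"
        by (simp add: has_vector_derivative_def)
    qed (use h in auto)
    then obtain k where k: "0 < k" "k < h" "norm (r h - r 0) \<le> h * norm (r' k)"
      using h by auto
    have "norm (r' k) \<le> C * k ^ n"
      unfolding r'_def using k h t by (intro C) auto
    also have "\<dots> \<le> C * h ^ n"
      using k \<open>C \<ge> 0\<close> by (intro mult_left_mono power_mono) auto
    finally have "norm (r h - r 0) \<le> h * (C * h ^ n)"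
      using k h by (meson less_imp_le mult_left_mono order.trans)
    then show ?thesis
      by (simp add: r_def mult_ac)
  qed
  then show ?thesis
    using h0 by (intro unif_bigoI[where C = C]) (auto simp: eventually_at_right_field)
qed

lemma C_2_unif_bigo_lipschitz:
  fixes f :: "'a::euclidean_space \<Rightarrow> 'c::real_normed_vector"
  assumes "C_k 2 f" "unif_bigo D 0 Y" "unif_bigo D 1 (\<lambda>h x. g h x - Y h x)"
  shows "unif_bigo D 1 (\<lambda>h x. f (g h x) - f (Y h x))"
  using unif_bigo_add[OF unif_bigo_mono[OF C_2_unif_bigo_taylor[OF assms], of 1]
      unif_bigo_frechet_derivative[OF assms]]
  by simp

text \<open>Bootstrapping: an expansion of y yields one of F along y, and integrating it improves
  the expansion of y by one order. Three rounds lead from boundedness to order 3.\<close>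

lemma ivp_solution_expansion:
  fixes f g :: "'a::euclidean_space \<Rightarrow> 'a"
  assumes f: "C_k 2 f" and g: "C_k 2 g" and y: "ivp_solution (\<lambda>x. f x + g x) t0 T a y"
  defines "D \<equiv> \<lambda>h t. t0 \<le> t \<and> t + h \<le> T"
    and "F \<equiv> \<lambda>t. f (y t) + g (y t)"
    and "F' \<equiv> \<lambda>t v. frechet_derivative f (at (y t)) v + frechet_derivative g (at (y t)) v"
  shows "unif_bigo D 0 (\<lambda>h. y)"
    and "unif_bigo D 3 (\<lambda>h t. y (t + h) - (y t + h *\<^sub>R F t + (h\<^sup>2 / 2) *\<^sub>R F' t (F t)))"
proof -
  have deriv: "(y has_vector_derivative F t) (at t within {t0..T})" if "t \<in> {t0..T}" for t
    using y that by (auto simp: ivp_solution_def F_def)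
  have "continuous_on {t0..T} y"
    using deriv by (meson continuous_on_eq_continuous_within has_vector_derivative_continuous)
  then have "bounded (y ` {t0..T})"
    by (intro compact_imp_bounded compact_continuous_image) auto
  then obtain B where B: "\<And>t. t \<in> {t0..T} \<Longrightarrow> norm (y t) \<le> B"
    unfolding bounded_iff by blast
  show Y: "unif_bigo D 0 (\<lambda>h. y)"
    unfolding unif_bigo_0_iff D_def
    by (rule exI[of _ B], use eventually_at_right_0_pos in eventually_elim) (auto intro: B)
  have Yh: "unif_bigo D 0 (\<lambda>h t. y (t + h))"
    unfolding unif_bigo_0_iff D_def
    by (rule exI[of _ B], use eventually_at_right_0_pos in eventually_elim) (auto intro: B)
  have F_bounded: "unif_bigo D 0 (\<lambda>h t. f (z h t) + g (z h t))" if "unif_bigo D 0 z" for z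
    using f g that
    by (auto intro!: unif_bigo_add unif_bigo_compose_bounded[of f] unif_bigo_compose_bounded[of g]
        differentiable_imp_continuous_on_UNIV C_2_differentiable(1))
  \<comment> \<open>The three rounds integrate with (P, Q) equal to (0, 0), then (F, 0), then (F, F'
    F).\<close>
  have "unif_bigo D 0 (\<lambda>h t. F (t + h) - (0 + h *\<^sub>R 0))"
    using F_bounded[OF Yh] by (simp add: F_def)
  from unif_bigo_integrate[OF deriv this[unfolded D_def]]
  have 1: "unif_bigo D 1 (\<lambda>h t. y (t + h) - y t)"
    by (simp add: D_def)
  have "unif_bigo D 1 (\<lambda>h t. F (t + h) - (F t + h *\<^sub>R 0))"
    using unif_bigo_add[OF C_2_unif_bigo_lipschitz[OF f Y 1] C_2_unif_bigo_lipschitz[OF g Y 1]]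
    by (simp add: F_def algebra_simps)
  from unif_bigo_integrate[OF deriv this[unfolded D_def]]
  have 2: "unif_bigo D 2 (\<lambda>h t. y (t + h) - (y t + h *\<^sub>R F t))"
    by (simp add: D_def numeral_2_eq_2)
  have F0: "unif_bigo D 0 (\<lambda>h. F)"
    using F_bounded[OF Y] by (simp add: F_def)
  have "unif_bigo D 2 (\<lambda>h t. F (t + h) - (F t + h *\<^sub>R F' t (F t)))"
    using unif_bigo_add[OF C_2_unif_bigo_expansion[OF f Y F0 2] C_2_unif_bigo_expansion[OF g Y F0 2]]
    by (rule unif_bigo_cong) (simp add: F_def F'_def algebra_simps)
  from unif_bigo_integrate[OF deriv this[unfolded D_def]]
  show "unif_bigo D 3 (\<lambda>h t. y (t + h) - (y t + h *\<^sub>R F t + (h\<^sup>2 / 2) *\<^sub>R F' t (F t)))"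
    by (simp add: D_def numeral_3_eq_3 numeral_2_eq_2)
qed

section \<open>Comparison of the method with the exact solution\<close>

theorem theorem3p2:
  fixes s m :: nat and \<eta> t0 T :: real
    and f_D f_A :: "real ^ 'd \<Rightarrow> real ^ 'd"
    and a :: "real ^ 'd"
  assumes "s \<ge> 2" and "m \<ge> 1" and "\<eta> \<ge> 0"
    and "C_k 2 f_D" and "C_k 2 f_A"
    and "t0 < T"
  shows "consistent_of_order 2 (prkc_step s m \<eta> f_D f_A) (\<lambda>x. f_D x + f_A x) t0 T a"
  unfolding consistent_of_order_def
proof (intro allI impI)
  fix y assume y: "ivp_solution (\<lambda>x. f_D x + f_A x) t0 T a y"
  note D = \<open>C_k 2 f_D\<close> and A = \<open>C_k 2 f_A\<close>
  let ?dom = "\<lambda>h t. t0 \<le> t \<and> t + h \<le> T"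
  let ?F = "\<lambda>t. f_D (y t) + f_A (y t)"
  let ?D' = "\<lambda>t. frechet_derivative f_D (at (y t))" and ?A' = "\<lambda>t. frechet_derivative f_A (at (y t))"
  have linD: "linear (?D' t)" and linA: "linear (?A' t)" for t
    by (intro linear_frechet_derivative C_2_differentiable(1) D A)+
  note exact = ivp_solution_expansion[OF D A y]
  have "expands2 ?dom (\<lambda>h t. prkc_step s m \<eta> f_D f_A h (y t)) y ?F
      (\<lambda>t. (1 / 2) *\<^sub>R (?D' t (?F t) + ?A' t (?F t)))"
  proof (rule expands2_cong[OF expands2_prkc_post[OF A expands2_prkc_mid[OF \<open>\<eta> \<ge> 0\<close> D
          expands2_prkc_pre[OF A exact(1), of m m], of s s], of m m]])
    fix t
    have half: "real m / (2 * real m) = 1 / 2"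
      using \<open>m \<ge> 1\<close> by simp
    show "(real m / (2 * real m)) *\<^sub>R f_A (y t) + rkc_c \<eta> s s *\<^sub>R f_D (y t)
        + (real m / (2 * real m)) *\<^sub>R f_A (y t) = ?F t"
      by (simp add: half rkc_c_s[OF assms(3,1)] scaleR_add_left[symmetric])
    \<comment> \<open>The two advection halves give 1/4 of f_A'(f_A) in total; the action of the
      second half on the first supplies the other 1/4.\<close>
    have sum: "real m * (real m - 1) / (8 * (real m)\<^sup>2) + real m * (real m + 1) / (8 * (real m)\<^sup>2) = 1 / 4"
      using \<open>m \<ge> 1\<close> by (simp add: field_simps power2_eq_square)
    \<comment> \<open>Naming the first coefficient hides its dependence on m, and it cancels in the
      final simplification.\<close>
    define \<alpha> where "\<alpha> = real m * (real m - 1) / (8 * (real m)\<^sup>2)"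
    have \<beta>: "real m * (real m + 1) / (8 * (real m)\<^sup>2) = 1 / 4 - \<alpha>"
      using sum by (simp add: \<alpha>_def)
    show "(real m * (real m - 1) / (8 * (real m)\<^sup>2)) *\<^sub>R ?A' t (f_A (y t))
        + rkc_c \<eta> s s *\<^sub>R ?D' t ((real m / (2 * real m)) *\<^sub>R f_A (y t))
        + rkc_d \<eta> s s *\<^sub>R ?D' t (f_D (y t))
        + (real m / (2 * real m)) *\<^sub>R ?A' t ((real m / (2 * real m)) *\<^sub>R f_A (y t) + rkc_c \<eta> s s *\<^sub>R f_D (y t))
        + (real m * (real m + 1) / (8 * (real m)\<^sup>2)) *\<^sub>R ?A' t (f_A (y t))
        = (1 / 2) *\<^sub>R (?D' t (?F t) + ?A' t (?F t))"
      unfolding half \<beta> \<alpha>_def[symmetric] rkc_c_s[OF assms(3,1)] rkc_d_s[OF assms(3,1)]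
        linear_add[OF linD] linear_scale[OF linD] linear_add[OF linA] linear_scale[OF linA]
      by (simp add: algebra_simps)
  qed (simp_all add: prkc_step_def)
  then have "unif_bigo ?dom 3 (\<lambda>h t. prkc_step s m \<eta> f_D f_A h (y t)
      - (y t + h *\<^sub>R ?F t + h\<^sup>2 *\<^sub>R (1 / 2) *\<^sub>R (?D' t (?F t) + ?A' t (?F t))))"
    by (simp add: expands2_def)
  from unif_bigo_diff[OF exact(2) this]
  have "unif_bigo ?dom 3 (\<lambda>h t. y (t + h) - prkc_step s m \<eta> f_D f_A h (y t))"
    by simp
  then obtain C where "eventually (\<lambda>h. \<forall>t. t0 \<le> t \<and> t + h \<le> T \<longrightarrow>
      norm (y (t + h) - prkc_step s m \<eta> f_D f_A h (y t)) \<le> C * h ^ 3) (at_right 0)"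
    unfolding unif_bigo_def by blast
  then show "\<exists>C h0. h0 > 0 \<and> (\<forall>h t. 0 < h \<and> h < h0 \<and> t0 \<le> t \<and> t + h \<le> T \<longrightarrow>
      norm (y (t + h) - prkc_step s m \<eta> f_D f_A h (y t)) \<le> C * h ^ (2 + 1))"
    unfolding eventually_at_right_field by (auto simp: numeral_3_eq_3)
qed

end
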